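(* Let $V$ be a finite-dimensional vector space and let $M$ be a $q$-transversal matroid on $V$ of rank $r$. Then $M$ has a presentation consisting of exactly $r$ subspaces, i.e. there is a family $(X_1,\dots,X_r)$ of subspaces of $V$ whose partial $q$-transversals are exactly the independent subspaces of $M$.
   Context: A $q$-matroid on $V$ is given by a rank function on subspaces with $0\le r(A)\le\dim A$, monotone and submodular; a subspace $A$ is independent if $r(A)=\dim A$; the rank of $M$ is $r(V)$. For a finite family $\mathcal{X}=(X_i:i\in I)$ of subspaces of $V$, a partial $q$-transversal is a subspace $T$ such that every vector basis $B$ of $T$ admits an injection $\pi:B\to I$ with $b\notin X_{\pi(b)}$ for all $b\in B$. $\mathcal{X}$ is a presentation of $M$ if the partial $q$-transversals of $\mathcal{X}$ are exactly the independent subspaces of $M$; $M$ is a $q$-transversal matroid if it has a presentation. *)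

theory Defs
  imports HOL.Vector_Spaces
begin

text \<open>The ground space \<open>V\<close> is the whole type \<open>'b\<close>, a vector space over a field \<open>'a\<close> with scalar
  multiplication \<open>scale\<close>. A q-matroid is given by its rank function \<open>rk\<close>, only whose values on
  subspaces are relevant; \<open>0 \<le> rk A\<close> is built into the type \<open>nat\<close>.\<close>

context vector_space
begin

definition q_matroid :: "('b set \<Rightarrow> nat) \<Rightarrow> bool" where
  "q_matroid rk \<longleftrightarrow>
     (\<forall>A. subspace A \<longrightarrow> rk A \<le> dim A) \<and>
     (\<forall>A B. subspace A \<and> subspace B \<and> A \<subseteq> B \<longrightarrow> rk A \<le> rk B) \<and>
     (\<forall>A B. subspace A \<and> subspace B \<longrightarrow> rk (span (A \<union> B)) + rk (A \<inter> B) \<le> rk A + rk B)"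

definition q_independent :: "('b set \<Rightarrow> nat) \<Rightarrow> 'b set \<Rightarrow> bool" where
  "q_independent rk A \<longleftrightarrow> subspace A \<and> rk A = dim A"

definition partial_q_transversal :: "'i set \<Rightarrow> ('i \<Rightarrow> 'b set) \<Rightarrow> 'b set \<Rightarrow> bool" where
  "partial_q_transversal I X T \<longleftrightarrow>
     subspace T \<and>
     (\<forall>B. independent B \<and> span B = T \<longrightarrow>
        (\<exists>\<pi>. inj_on \<pi> B \<and> \<pi> ` B \<subseteq> I \<and> (\<forall>b\<in>B. b \<notin> X (\<pi> b))))"

definition q_presentation :: "('b set \<Rightarrow> nat) \<Rightarrow> 'i set \<Rightarrow> ('i \<Rightarrow> 'b set) \<Rightarrow> bool" where
  "q_presentation rk I X \<longleftrightarrow>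
     finite I \<and> (\<forall>i\<in>I. subspace (X i)) \<and>
     (\<forall>T. partial_q_transversal I X T \<longleftrightarrow> q_independent rk T)"

text \<open>Index sets of natural numbers suffice, since the index set is finite; see
  \<open>q_presentation_imp_transversal\<close> below.\<close>

definition q_transversal_matroid :: "('b set \<Rightarrow> nat) \<Rightarrow> bool" where
  "q_transversal_matroid rk \<longleftrightarrow>
     q_matroid rk \<and> (\<exists>(I :: nat set) X. q_presentation rk I X)"

lemma partial_q_transversal_reindex:
  assumes h: "bij_betw h J I" and T: "partial_q_transversal I X T"
  shows "partial_q_transversal J (X \<circ> h) T"
  unfolding partial_q_transversal_def
proof (intro conjI allI impI)
  show "subspace T" using T by (simp add: partial_q_transversal_def)
  fix B assume "independent B \<and> span B = T"
  then obtain \<pi> where p: "inj_on \<pi> B" "\<pi> ` B \<subseteq> I" "\<forall>b\<in>B. b \<notin> X (\<pi> b)"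
    using T unfolding partial_q_transversal_def by blast
  let ?g = "inv_into J h"
  have g: "bij_betw ?g I J" using h by (rule bij_betw_inv_into)
  have "inj_on (?g \<circ> \<pi>) B"
    using p g by (intro comp_inj_on) (auto simp: bij_betw_def intro: inj_on_subset)
  moreover have "(?g \<circ> \<pi>) ` B \<subseteq> J" using p(2) g by (auto simp: bij_betw_def)
  moreover have "\<forall>b\<in>B. b \<notin> (X \<circ> h) ((?g \<circ> \<pi>) b)"
    using p(2,3) h by (auto simp: bij_betw_inv_into_right image_subset_iff)
  ultimately show "\<exists>\<pi>. inj_on \<pi> B \<and> \<pi> ` B \<subseteq> J \<and> (\<forall>b\<in>B. b \<notin> (X \<circ> h) (\<pi> b))" by blast
qed

lemma partial_q_transversal_cong:
  assumes "\<And>i. i \<in> I \<Longrightarrow> X i = Y i"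
  shows "partial_q_transversal I X T \<longleftrightarrow> partial_q_transversal I Y T"
proof -
  have "(\<pi> ` B \<subseteq> I \<and> (\<forall>b\<in>B. b \<notin> X (\<pi> b))) \<longleftrightarrow> (\<pi> ` B \<subseteq> I \<and> (\<forall>b\<in>B. b \<notin> Y (\<pi> b)))" for \<pi> B
    using assms by (auto simp: image_subset_iff)
  then show ?thesis unfolding partial_q_transversal_def by simp
qed

lemma q_presentation_reindex:
  assumes h: "bij_betw h J I" and p: "q_presentation rk I X"
  shows "q_presentation rk J (X \<circ> h)"
proof -
  have "partial_q_transversal J (X \<circ> h) T \<longleftrightarrow> partial_q_transversal I X T" for T
  proof
    assume "partial_q_transversal J (X \<circ> h) T"
    then have "partial_q_transversal I (X \<circ> h \<circ> inv_into J h) T"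
      by (rule partial_q_transversal_reindex[OF bij_betw_inv_into[OF h]])
    then show "partial_q_transversal I X T"
      using partial_q_transversal_cong[of I "X \<circ> h \<circ> inv_into J h" X T] h
      by (simp add: bij_betw_inv_into_right)
  qed (rule partial_q_transversal_reindex[OF h])
  moreover have "finite J" using h p by (auto simp: q_presentation_def bij_betw_finite)
  ultimately show ?thesis
    using h p by (auto simp: q_presentation_def bij_betw_def)
qed

lemma q_presentation_imp_transversal:
  assumes "q_matroid rk" and p: "q_presentation rk (I :: 'i set) X"
  shows "q_transversal_matroid rk"
proof -
  have "finite I" using p by (simp add: q_presentation_def)
  then obtain h where "bij_betw h {0..<card I} I"
    using ex_bij_betw_nat_finite by blast
  then show ?thesis
    using assms q_presentation_reindex unfolding q_transversal_matroid_def by blast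
qed

end

end

theory Submission
  imports Defs
begin

text \<open>
  For subspaces \<open>W\<close> let \<open>f(W)\<close> be the number of \<open>i\<close> with \<open>W \<not>\<le> X\<^sub>i\<close>. By Hall's theorem \<open>T\<close> is a
  partial q-transversal iff \<open>dim W \<le> f(W)\<close> for all \<open>W \<le> T\<close>, and \<open>f\<close> is submodular. Given a
  maximal independent \<open>T\<close>, let \<open>S\<close> be the largest subspace of \<open>T\<close> with \<open>f(S) = dim S\<close> and \<open>U\<close> the
  intersection of the \<open>X\<^sub>i\<close> containing \<open>S\<close>. Maximality of \<open>T\<close> forces \<open>T + U = V\<close>, whence
  \<open>f(U) + codim U = dim T = r\<close>, the minimum of \<open>f(W) + codim W\<close> over all \<open>W\<close>. Replacing the members
  of the family that contain \<open>U\<close> by \<open>codim U\<close> copies of \<open>U\<close> itself leaves \<open>r\<close> subspaces and, by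
  submodularity and minimality, does not change the partial q-transversals.
\<close>

section \<open>Hall's marriage theorem\<close>

text \<open>Induction in the style of Halmos and Vaughan. If some proper nonempty subset is tight,
  it and its complement are matched separately. Otherwise every such subset has slack, which pays
  for giving an arbitrary index to one element and deleting that index everywhere.\<close>

lemma hall_marriage:
  fixes A :: "'b \<Rightarrow> 'i set"
  assumes "finite B" and "\<And>b. b \<in> B \<Longrightarrow> finite (A b)"
    and "\<And>S. S \<subseteq> B \<Longrightarrow> card S \<le> card (\<Union>(A ` S))"
  shows "\<exists>\<pi>. inj_on \<pi> B \<and> (\<forall>b\<in>B. \<pi> b \<in> A b)"
  using assms
proof (induction B arbitrary: A rule: finite_psubset_induct)
  case (psubset B)
  note fin = psubset.prems(1) and hall = psubset.prems(2)
  have finU: "finite (\<Union>(A ` S))" if "S \<subseteq> B" for S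
    using that fin psubset.hyps by (auto dest: finite_subset)
  consider "B = {}" | S where "S \<subset> B" "S \<noteq> {}" "card S = card (\<Union>(A ` S))"
    | "B \<noteq> {}" "\<And>S. S \<subset> B \<Longrightarrow> S \<noteq> {} \<Longrightarrow> card S < card (\<Union>(A ` S))"
    using hall by (metis le_neq_implies_less psubset_imp_subset)
  then show ?case
  proof cases
    case 1
    then show ?thesis by simp
  next
    case (2 S)
    let ?N = "\<Union>(A ` S)" and ?A = "\<lambda>b. A b - \<Union>(A ` S)"
    have "\<exists>\<pi>. inj_on \<pi> S \<and> (\<forall>b\<in>S. \<pi> b \<in> A b)"
      using 2 fin hall by (intro psubset.IH) auto
    then obtain \<pi>1 where \<pi>1: "inj_on \<pi>1 S" "\<forall>b\<in>S. \<pi>1 b \<in> A b" by blast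
    \<comment> \<open>Hall's condition survives deleting \<open>?N\<close>: apply it to
      \<open>R \<union> S\<close> and cancel the equal cardinalities of \<open>S\<close> and
      \<open>?N\<close>.\<close>
    have "\<exists>\<pi>. inj_on \<pi> (B - S) \<and> (\<forall>b\<in>B - S. \<pi> b \<in> ?A b)"
    proof (rule psubset.IH)
      show "B - S \<subset> B" using 2 by auto
      show "finite (?A b)" if "b \<in> B - S" for b using that fin by auto
      fix R assume R: "R \<subseteq> B - S"
      have finRS: "finite R" "finite S"
        using R 2 psubset.hyps by (auto dest: finite_subset)
      have "card R + card S = card (R \<union> S)"
        using R finRS by (subst card_Un_disjoint) auto
      also have "\<dots> \<le> card (\<Union>(A ` (R \<union> S)))" using R 2 by (intro hall) auto
      also have "\<Union>(A ` (R \<union> S)) = \<Union>(?A ` R) \<union> ?N" by auto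
      also have "card \<dots> = card (\<Union>(?A ` R)) + card ?N"
      proof (rule card_Un_disjoint)
        show "finite (\<Union>(?A ` R))" using R finU[of R] by (auto elim!: finite_subset[rotated])
        show "finite ?N" using 2 by (intro finU) auto
      qed auto
      finally show "card R \<le> card (\<Union>(?A ` R))" using 2 by simp
    qed
    then obtain \<pi>2 where \<pi>2: "inj_on \<pi>2 (B - S)" "\<forall>b\<in>B - S. \<pi>2 b \<in> ?A b" by blast
    let ?p = "\<lambda>b. if b \<in> S then \<pi>1 b else \<pi>2 b"
    have "inj_on ?p B"
    proof (rule inj_onI)
      fix x y assume xy: "x \<in> B" "y \<in> B" and eq: "?p x = ?p y"
      have "x \<in> S \<longleftrightarrow> y \<in> S"
      proof (rule ccontr)
        assume "(x \<in> S) \<noteq> (y \<in> S)"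
        then have "(?p x \<in> ?N) \<noteq> (?p y \<in> ?N)" using xy \<pi>1(2) \<pi>2(2) by fastforce
        with eq show False by simp
      qed
      then show "x = y" using xy eq inj_onD[OF \<pi>1(1)] inj_onD[OF \<pi>2(1)] by (cases "x \<in> S") auto
    qed
    then show ?thesis using \<pi>1 \<pi>2 by (intro exI[of _ ?p]) auto
  next
    case 3
    then obtain b where b: "b \<in> B" by blast
    have "A b \<noteq> {}" using hall[of "{b}"] b by auto
    then obtain i where i: "i \<in> A b" by blast
    let ?A = "\<lambda>c. A c - {i}"
    have "\<exists>\<pi>. inj_on \<pi> (B - {b}) \<and> (\<forall>c\<in>B - {b}. \<pi> c \<in> ?A c)"
    proof (rule psubset.IH)
      show "B - {b} \<subset> B" using b by auto
      show "finite (?A c)" if "c \<in> B - {b}" for c using that fin by auto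
      fix R assume R: "R \<subseteq> B - {b}"
      show "card R \<le> card (\<Union>(?A ` R))"
      proof (cases "R = {}")
        case False
        then have "card R < card (\<Union>(A ` R))" using R b by (intro 3) auto
        also have "\<dots> \<le> Suc (card (\<Union>(A ` R) - {i}))"
          by (simp add: card_Diff_singleton_if) linarith
        also have "\<Union>(A ` R) - {i} = \<Union>(?A ` R)" by auto
        finally show ?thesis by simp
      qed simp
    qed
    then obtain \<pi> where \<pi>: "inj_on \<pi> (B - {b})" "\<forall>c\<in>B - {b}. \<pi> c \<in> ?A c" by blast
    have "inj_on (\<pi>(b := i)) B" using \<pi> by (auto simp: inj_on_def)
    moreover have "\<forall>c\<in>B. (\<pi>(b := i)) c \<in> A c" using \<pi>(2) i by auto
    ultimately show ?thesis by blast
  qed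
qed

section \<open>Escape counts and Hall's criterion for partial q-transversals\<close>

text \<open>The size of the Hall neighbourhood of \<open>W\<close>: the indices available to at
  least one vector of \<open>W\<close>. Allowing arbitrary sets \<open>W\<close> makes it applicable
  to bases.\<close>

definition escapes :: "'i set \<Rightarrow> ('i \<Rightarrow> 'b set) \<Rightarrow> 'b set \<Rightarrow> nat" where
  "escapes I X W = card {i\<in>I. \<not> W \<subseteq> X i}"

lemma escapes_mono:
  assumes "finite I" and "W \<subseteq> W'"
  shows "escapes I X W \<le> escapes I X W'"
  unfolding escapes_def using assms by (intro card_mono) auto

context finite_dimensional_vector_space
begin

lemma ex_max_dim:
  assumes "P A"
  shows "\<exists>S. P S \<and> (\<forall>S'. P S' \<longrightarrow> dim S' \<le> dim S)"
  using assms dim_subset_UNIV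
  by (intro ex_has_greatest_nat[where b = "Suc dimension"]) (auto simp: less_Suc_eq_le)

lemma dim_span_Un_Int:
  assumes "subspace S" and "subspace T"
  shows "dim (span (S \<union> T)) + dim (S \<inter> T) = dim S + dim T"
  using dim_sums_Int[OF assms] assms by (simp add: span_Un span_eq_iff[THEN iffD2] del: dim_span)

lemma escapes_span:
  assumes "\<forall>i\<in>I. subspace (X i)"
  shows "escapes I X (span S) = escapes I X S"
proof -
  have "span S \<subseteq> X i \<longleftrightarrow> S \<subseteq> X i" if "i \<in> I" for i
    using assms that span_minimal span_superset by blast
  then show ?thesis unfolding escapes_def by (metis (no_types, lifting))
qed

text \<open>Coverage functions are submodular: the escaped indices of a union are the union of the
  escaped indices, while those of an intersection lie in both sets.\<close>

lemma escapes_submodular: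
  assumes "finite I" and "\<forall>i\<in>I. subspace (X i)"
  shows "escapes I X (span (A \<union> B)) + escapes I X (A \<inter> B) \<le> escapes I X A + escapes I X B"
proof -
  let ?E = "\<lambda>W. {i\<in>I. \<not> W \<subseteq> X i}"
  have "?E (A \<union> B) = ?E A \<union> ?E B" by auto
  then have "escapes I X (span (A \<union> B)) = card (?E A \<union> ?E B)"
    using escapes_span[OF assms(2)] by (simp add: escapes_def del: Un_subset_iff)
  moreover have "escapes I X (A \<inter> B) \<le> card (?E A \<inter> ?E B)"
    unfolding escapes_def using assms(1) by (intro card_mono) auto
  moreover have "card (?E A) + card (?E B) = card (?E A \<union> ?E B) + card (?E A \<inter> ?E B)"
    using assms(1) by (intro card_Un_Int) auto
  ultimately show ?thesis unfolding escapes_def by linarith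
qed

text \<open>Left to right, a basis of \<open>W\<close> is extended to one of \<open>T\<close>, whose
  matching sends the basis of \<open>W\<close> injectively to indices that \<open>W\<close> escapes.
  Right to left is Hall's theorem for each basis, using that a subset and its span escape the same
  indices.\<close>

lemma partial_q_transversal_iff:
  assumes fin: "finite I" and sub: "\<forall>i\<in>I. subspace (X i)"
  shows "partial_q_transversal I X T \<longleftrightarrow>
    subspace T \<and> (\<forall>W. subspace W \<and> W \<subseteq> T \<longrightarrow> dim W \<le> escapes I X W)"
proof (intro iffI conjI allI impI)
  assume T: "partial_q_transversal I X T"
  then show subT: "subspace T" by (simp add: partial_q_transversal_def)
  fix W assume W: "subspace W \<and> W \<subseteq> T"
  obtain S where S: "S \<subseteq> W" "independent S" "W \<subseteq> span S" "card S = dim W"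
    using basis_exists by blast
  obtain B where B: "S \<subseteq> B" "B \<subseteq> T" "independent B" "T \<subseteq> span B"
    using maximal_independent_subset_extend[of S T] S W by blast
  have "span B = T" using B subT span_minimal by blast
  then obtain \<pi> where \<pi>: "inj_on \<pi> B" "\<pi> ` B \<subseteq> I" "\<forall>b\<in>B. b \<notin> X (\<pi> b)"
    using T B unfolding partial_q_transversal_def by blast
  have "\<pi> ` S \<subseteq> {i\<in>I. \<not> W \<subseteq> X i}" using \<pi>(2,3) B(1) S(1) by blast
  then have "card (\<pi> ` S) \<le> card {i\<in>I. \<not> W \<subseteq> X i}" using fin by (intro card_mono) auto
  moreover have "card (\<pi> ` S) = card S"
    using \<pi> B by (intro card_image) (auto intro: inj_on_subset)
  ultimately show "dim W \<le> escapes I X W" using S by (simp add: escapes_def)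
next
  assume T: "subspace T \<and> (\<forall>W. subspace W \<and> W \<subseteq> T \<longrightarrow> dim W \<le> escapes I X W)"
  show "partial_q_transversal I X T"
    unfolding partial_q_transversal_def
  proof (intro conjI allI impI)
    show "subspace T" using T by simp
    fix B assume B: "independent B \<and> span B = T"
    have "\<exists>\<pi>. inj_on \<pi> B \<and> (\<forall>b\<in>B. \<pi> b \<in> {i\<in>I. b \<notin> X i})"
    proof (rule hall_marriage)
      show "finite B" using B finiteI_independent by blast
      show "finite {i\<in>I. b \<notin> X i}" for b using fin by simp
      fix S assume S: "S \<subseteq> B"
      then have "independent S" using B independent_mono by blast
      then have "card S = dim (span S)" by (simp add: dim_eq_card_independent)
      also have "\<dots> \<le> escapes I X (span S)" using T B S span_mono by blast
      also have "\<dots> = escapes I X S" using sub by (rule escapes_span)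
      also have "\<dots> = card (\<Union>b\<in>S. {i\<in>I. b \<notin> X i})"
        unfolding escapes_def by (intro arg_cong[of _ _ card]) auto
      finally show "card S \<le> card (\<Union>b\<in>S. {i\<in>I. b \<notin> X i})" .
    qed
    then show "\<exists>\<pi>. inj_on \<pi> B \<and> \<pi> ` B \<subseteq> I \<and> (\<forall>b\<in>B. b \<notin> X (\<pi> b))" by blast
  qed
qed

section \<open>Maximal independent subspaces and the rank\<close>

lemma dim_span_insert_notin:
  assumes "subspace T" and "x \<notin> T"
  shows "dim (span (insert x T)) = Suc (dim T)"
  using assms by (simp add: dim_insert span_eq_iff[THEN iffD2])

text \<open>This ties \<open>rk UNIV\<close> to independent subspaces, the only data that a
  presentation controls. One extra vector cannot raise the rank of \<open>T\<close>, and
  submodularity carries this over to finitely many, in particular to a basis of the whole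
  space.\<close>

lemma rk_maximal_independent:
  assumes M: "q_matroid rk" and T: "q_independent rk T"
    and max: "\<And>x. x \<notin> T \<Longrightarrow> \<not> q_independent rk (span (insert x T))"
  shows "rk UNIV = dim T"
proof -
  have subT: "subspace T" and rkT: "rk T = dim T" using T by (auto simp: q_independent_def)
  have le_dim: "rk A \<le> dim A" if "subspace A" for A
    using M that unfolding q_matroid_def by blast
  have mono: "rk A \<le> rk B" if "subspace A" "subspace B" "A \<subseteq> B" for A B
    using M that unfolding q_matroid_def by blast
  have submod: "rk (span (A \<union> B)) + rk (A \<inter> B) \<le> rk A + rk B" if "subspace A" "subspace B" for A B
    using M that unfolding q_matroid_def by blast
  have step: "rk (span (insert x T)) \<le> dim T" for x
  proof (cases "x \<in> T")
    case True
    then show ?thesis using subT rkT by (simp add: insert_absorb span_eq_iff[THEN iffD2])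
  next
    case False
    then have "rk (span (insert x T)) \<noteq> Suc (dim T)"
      using max[OF False] dim_span_insert_notin[OF subT False]
      by (auto simp: q_independent_def)
    then show ?thesis
      using le_dim[of "span (insert x T)"] dim_span_insert_notin[OF subT False] by simp
  qed
  have "rk (span (T \<union> F)) = dim T" if "finite F" for F
    using that
  proof (induction F)
    case empty
    then show ?case using subT rkT by (simp add: span_eq_iff[THEN iffD2])
  next
    case (insert x F)
    let ?A = "span (T \<union> F)" and ?B = "span (insert x T)"
    have TA: "T \<subseteq> ?A" "T \<subseteq> ?B" by (auto intro: span_base)
    have "span (?A \<union> ?B) = span (T \<union> insert x F)"
    proof (rule antisym)
      show "span (?A \<union> ?B) \<subseteq> span (T \<union> insert x F)"
        by (intro span_minimal Un_least subspace_span span_mono) auto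
      show "span (T \<union> insert x F) \<subseteq> span (?A \<union> ?B)"
        by (intro span_mono) (auto intro: span_base)
    qed
    \<comment> \<open>Both \<open>?A\<close> and \<open>?B\<close> have rank at most
      \<open>dim T\<close>, and their intersection contains \<open>T\<close>, so the sum has rank at
      most \<open>dim T\<close> as well.\<close>
    then have "rk (span (T \<union> insert x F)) + rk (?A \<inter> ?B) \<le> rk ?A + rk ?B"
      using submod[of ?A ?B] by simp
    moreover have "rk T \<le> rk (?A \<inter> ?B)" "rk T \<le> rk (span (T \<union> insert x F))"
      using TA subT by (auto intro!: mono subspace_inter intro: span_base)
    ultimately show ?case using insert.IH step[of x] rkT by linarith
  qed
  from this[OF finite_Basis] show ?thesis
    using span_Basis span_mono[of Basis "T \<union> Basis"] by (simp add: top.extremum_unique)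
qed

section \<open>Tight subspaces and min-max duality\<close>

text \<open>Uncrossing: Hall's inequalities for the sum and the intersection add up to the reverse
  of submodularity, so both are equalities.\<close>

lemma escapes_tight_span_Un:
  assumes fin: "finite I" and sub: "\<forall>i\<in>I. subspace (X i)"
    and T: "partial_q_transversal I X T"
    and A: "subspace A" "A \<subseteq> T" "escapes I X A = dim A"
    and B: "subspace B" "B \<subseteq> T" "escapes I X B = dim B"
  shows "escapes I X (span (A \<union> B)) = dim (span (A \<union> B))"
proof -
  have T': "subspace T" "\<And>W. subspace W \<Longrightarrow> W \<subseteq> T \<Longrightarrow> dim W \<le> escapes I X W"
    using T partial_q_transversal_iff[OF fin sub] by auto
  have "span (A \<union> B) \<subseteq> T" using A B T' by (simp add: span_minimal)
  then have "dim (span (A \<union> B)) \<le> escapes I X (span (A \<union> B))" by (intro T') auto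
  moreover have "dim (A \<inter> B) \<le> escapes I X (A \<inter> B)"
    using A B by (intro T') (auto intro: subspace_inter)
  moreover note escapes_submodular[OF fin sub, of A B]
    dim_span_Un_Int[OF A(1) B(1)]
  ultimately show ?thesis using A B by linarith
qed

text \<open>The resulting \<open>U\<close> certifies that \<open>T\<close> has the largest possible
  dimension: it attains equality in the weak duality bound
  \<open>dim_transversal_le\<close>.\<close>

lemma maximal_transversal_dual:
  assumes fin: "finite I" and sub: "\<forall>i\<in>I. subspace (X i)"
    and T: "partial_q_transversal I X T"
    and max: "\<And>x. x \<notin> T \<Longrightarrow> \<not> partial_q_transversal I X (span (insert x T))"
  obtains U where "subspace U" "escapes I X U + dim UNIV \<le> dim T + dim U"
proof -
  let ?f = "escapes I X"
  have subT: "subspace T" and hall: "\<And>W. subspace W \<Longrightarrow> W \<subseteq> T \<Longrightarrow> dim W \<le> ?f W"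
    using T partial_q_transversal_iff[OF fin sub] by auto
  define tight where "tight = (\<lambda>S. subspace S \<and> S \<subseteq> T \<and> ?f S = dim S)"
  have no_escape: "{i\<in>I. \<not> {0} \<subseteq> X i} = {}" using sub subspace_0 by blast
  have "?f {0} = 0" unfolding escapes_def no_escape by simp
  then have "tight {0}" using subT subspace_0[of T] by (simp add: tight_def)
  then obtain S where S: "tight S" and S_max: "\<And>S'. tight S' \<Longrightarrow> dim S' \<le> dim S"
    using ex_max_dim by blast
  have S': "subspace S" "S \<subseteq> T" "?f S = dim S" using S by (auto simp: tight_def)
  \<comment> \<open>Tight subspaces are closed under sums, so the one of largest dimension contains
    all others.\<close>
  have tight_le: "A \<subseteq> S" if "tight A" for A
  proof -
    have "tight (span (S \<union> A))"
      using S' that subT escapes_tight_span_Un[OF fin sub T, of S A]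
      by (auto simp: tight_def span_minimal)
    then have "dim (span (S \<union> A)) \<le> dim S" by (rule S_max)
    then have "S = span (S \<union> A)"
      using S' by (intro subspace_dim_equal) (auto intro: span_base)
    then show ?thesis using span_base by blast
  qed
  \<comment> \<open>\<open>U\<close> is the largest subspace escaping only indices that
    \<open>S\<close> escapes; it is the whole space if no member of the family contains
    \<open>S\<close>.\<close>
  define U where "U = (\<Inter>i\<in>{i\<in>I. S \<subseteq> X i}. X i)"
  have subU: "subspace U" unfolding U_def using sub by (intro subspace_Inter) auto
  have SU: "S \<subseteq> U" by (auto simp: U_def)
  have fU: "?f U = ?f S" unfolding escapes_def U_def by (intro arg_cong[of _ _ card]) auto
  have "x \<in> span (T \<union> U)" for x
  proof (cases "x \<in> T")
    case True
    then show ?thesis by (simp add: span_base)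
  next
    case False
    let ?Tx = "span (insert x T)"
    \<comment> \<open>A violator of Hall's condition created by adding \<open>x\<close>. It has at
      most one dimension more than \<open>W \<inter> T\<close>, where the condition holds, so
      \<open>W \<inter> T\<close> is tight and \<open>W\<close> escapes no further index.\<close>
    obtain W where W: "subspace W" "W \<subseteq> ?Tx" "?f W < dim W"
      using max[OF False] partial_q_transversal_iff[OF fin sub, of ?Tx]
      by (auto simp: not_le)
    have "\<not> W \<subseteq> T" using hall[of W] W by auto
    then obtain w where w: "w \<in> W" "w \<notin> T" by blast
    have subWT: "subspace (W \<inter> T)" using W subT by (simp add: subspace_inter)
    have dimW: "dim W \<le> Suc (dim (W \<inter> T))"
    proof -
      have "dim (span (W \<union> T)) \<le> dim ?Tx"
        using W by (intro dim_subset span_minimal) (auto intro: span_base)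
      then show ?thesis
        using dim_span_Un_Int[OF W(1) subT] dim_span_insert_notin[OF subT False] by linarith
    qed
    have fWT: "?f (W \<inter> T) \<le> ?f W" "dim (W \<inter> T) \<le> ?f (W \<inter> T)"
      using subWT by (auto intro: escapes_mono[OF fin] hall)
    then have eq: "?f (W \<inter> T) = dim (W \<inter> T)" "?f W = ?f (W \<inter> T)" using W dimW by linarith+
    then have "W \<inter> T \<subseteq> S" using subWT by (intro tight_le) (auto simp: tight_def)
    \<comment> \<open>Hence \<open>W\<close> lies in \<open>U\<close>, and its vector
      \<open>w\<close> outside \<open>T\<close> can be exchanged for \<open>x\<close>.\<close>
    have WX: "W \<subseteq> X i" if "i \<in> I" "S \<subseteq> X i" for i
    proof -
      have "{i\<in>I. \<not> W \<inter> T \<subseteq> X i} = {i\<in>I. \<not> W \<subseteq> X i}"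
        using eq(2) fin unfolding escapes_def by (intro card_subset_eq) auto
      then show ?thesis using that \<open>W \<inter> T \<subseteq> S\<close> by blast
    qed
    then have "w \<in> U" using w by (auto simp: U_def)
    moreover have "x \<in> span (insert w T)"
    proof (rule in_span_insert)
      show "w \<in> ?Tx" using w W by blast
      show "w \<notin> span T" using w subT span_eq_iff by metis
    qed
    ultimately show ?thesis using span_mono[of "insert w T" "T \<union> U"] by auto
  qed
  then have "span (T \<union> U) = UNIV" by blast
  then have "dim UNIV + dim (T \<inter> U) = dim T + dim U"
    using dim_span_Un_Int[OF subT subU] by simp
  moreover have "dim S \<le> dim (T \<inter> U)" using S' SU by (intro dim_subset) auto
  ultimately have "?f U + dim UNIV \<le> dim T + dim U" using fU S' by linarith
  with subU that show thesis by blast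
qed

text \<open>Weak duality: Hall's condition bounds the part of \<open>T\<close> inside
  \<open>U\<close>, and the rest of \<open>T\<close> has dimension at most the codimension of
  \<open>U\<close>.\<close>

lemma dim_transversal_le:
  assumes fin: "finite I" and sub: "\<forall>i\<in>I. subspace (X i)"
    and T: "partial_q_transversal I X T" and U: "subspace U"
  shows "dim T + dim U \<le> escapes I X U + dim UNIV"
proof -
  have T': "subspace T" "\<And>W. subspace W \<Longrightarrow> W \<subseteq> T \<Longrightarrow> dim W \<le> escapes I X W"
    using T partial_q_transversal_iff[OF fin sub] by auto
  have "dim (T \<inter> U) \<le> escapes I X (T \<inter> U)" using T' U by (intro T') (auto intro: subspace_inter)
  also have "\<dots> \<le> escapes I X U" using fin by (intro escapes_mono) auto
  finally show ?thesis
    using dim_span_Un_Int[OF T'(1) U] dim_subset[of "span (T \<union> U)" UNIV] by simp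
qed

section \<open>Shrinking the family to \<open>r\<close> members\<close>

text \<open>Both families have the same escape counts on subspaces of \<open>U\<close>. So it
  suffices that, for either family, Hall's condition at \<open>W\<close> follows from the condition
  at \<open>W \<inter> U\<close>.\<close>

lemma partial_q_transversal_replace:
  assumes fin: "finite I" and sub: "\<forall>i\<in>I. subspace (X i)"
    and U: "subspace U"
    and min: "\<And>W. subspace W \<Longrightarrow> escapes I X U + dim W \<le> escapes I X W + dim U"
    and k: "k + dim U = dim UNIV"
  shows "partial_q_transversal ({i\<in>I. \<not> U \<subseteq> X i} <+> {..<k}) (case_sum X (\<lambda>_. U)) T \<longleftrightarrow>
    partial_q_transversal I X T"
proof -
  let ?J = "{i\<in>I. \<not> U \<subseteq> X i}"
  let ?K = "?J <+> {..<k}" and ?Y = "case_sum X (\<lambda>_. U)"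
  have finK: "finite ?K" using fin by simp
  have subK: "\<forall>i\<in>?K. subspace (?Y i)" using sub U by auto
  have split: "escapes ?K ?Y W = escapes ?J X W + (if W \<subseteq> U then 0 else k)" for W
  proof -
    have "{i\<in>?K. \<not> W \<subseteq> ?Y i} = {i\<in>?J. \<not> W \<subseteq> X i} <+> (if W \<subseteq> U then {} else {..<k})"
      by auto
    then show ?thesis unfolding escapes_def using fin by (simp add: card_Plus)
  qed
  have J: "escapes ?J X W = escapes I X W" if "W \<subseteq> U" for W
    unfolding escapes_def using that by (intro arg_cong[of _ _ card]) auto
  have inter: "subspace (W \<inter> U)" if "subspace W" for W using that U by (rule subspace_inter)
  \<comment> \<open>By submodularity f(W) is at least f(W \<inter> U) + f(W + U) - f(U), and
    \<open>min\<close> at W + U bounds the last difference below by dim(W + U) - dim U.\<close>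
  have old: "dim W \<le> escapes I X W"
    if W: "subspace W" and "dim (W \<inter> U) \<le> escapes ?K ?Y (W \<inter> U)" for W
  proof -
    have "dim (W \<inter> U) \<le> escapes I X (W \<inter> U)" using that split[of "W \<inter> U"] J by simp
    moreover note escapes_submodular[OF fin sub, of W U]
      min[of "span (W \<union> U)"] dim_span_Un_Int[OF W U]
    ultimately show ?thesis by fastforce
  qed
  \<comment> \<open>If \<open>W\<close> is not inside \<open>U\<close>, it escapes all
    \<open>k\<close> copies of \<open>U\<close>, which covers dim(W + U) - dim U; the kept members
    account for \<open>W \<inter> U\<close>.\<close>
  have new: "dim W \<le> escapes ?K ?Y W"
    if W: "subspace W" "dim (W \<inter> U) \<le> escapes I X (W \<inter> U)" for W
  proof (cases "W \<subseteq> U")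
    case True
    then show ?thesis using that split[of W] J by (simp add: Int_absorb2)
  next
    case False
    have "escapes ?J X (W \<inter> U) \<le> escapes ?J X W" using fin by (intro escapes_mono) auto
    moreover have "dim (span (W \<union> U)) \<le> dim UNIV" by (intro dim_subset) auto
    ultimately show ?thesis
      using False that split[of W] J[of "W \<inter> U"] k dim_span_Un_Int[OF W(1) U] by simp
  qed
  show ?thesis
    unfolding partial_q_transversal_iff[OF finK subK] partial_q_transversal_iff[OF fin sub]
    using old new inter by (meson Int_lower1 order_trans)
qed

lemma q_presentation_card_rank:
  fixes X :: "'i \<Rightarrow> 'b set"
  assumes M: "q_matroid rk" and p: "q_presentation rk I X"
  shows "\<exists>X :: nat \<Rightarrow> 'b set. q_presentation rk {1..rk UNIV} X"
proof -
  let ?f = "escapes I X"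
  have fin: "finite I" and sub: "\<forall>i\<in>I. subspace (X i)"
    and pres: "\<And>T. partial_q_transversal I X T \<longleftrightarrow> q_independent rk T"
    using p by (auto simp: q_presentation_def)
  have "q_independent rk {0}"
    unfolding pres[symmetric] partial_q_transversal_iff[OF fin sub]
    by (auto dest: subset_singletonD)
  then obtain T where T: "q_independent rk T"
    and T_max: "\<And>T'. q_independent rk T' \<Longrightarrow> dim T' \<le> dim T"
    using ex_max_dim by blast
  have max: "\<not> q_independent rk (span (insert x T))" if "x \<notin> T" for x
    using T_max[of "span (insert x T)"] dim_span_insert_notin[OF _ that] T
    by (auto simp: q_independent_def)
  have r: "rk UNIV = dim T" using M T max by (rule rk_maximal_independent)
  obtain U where U: "subspace U" "?f U + dim UNIV \<le> dim T + dim U"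
    using maximal_transversal_dual[OF fin sub] T max pres by metis
  have bound: "dim T + dim W \<le> ?f W + dim UNIV" if "subspace W" for W
    using dim_transversal_le[OF fin sub _ that] T pres by blast
  define k where "k = dim UNIV - dim U"
  have k: "k + dim U = dim UNIV" unfolding k_def using dim_subset[of U UNIV] by simp
  let ?K = "{i\<in>I. \<not> U \<subseteq> X i} <+> {..<k}" and ?Y = "case_sum X (\<lambda>_. U)"
  have "partial_q_transversal ?K ?Y T' \<longleftrightarrow> partial_q_transversal I X T'" for T'
  proof (rule partial_q_transversal_replace[OF fin sub U(1) _ k])
    \<comment> \<open>Minimality of \<open>U\<close> is weak duality for \<open>W\<close> combined
      with the equality at \<open>U\<close>; \<open>dim T\<close> cancels.\<close>
    show "?f U + dim W \<le> ?f W + dim U" if "subspace W" for W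
      using bound[OF that] U(2) by linarith
  qed
  then have "q_presentation rk ?K ?Y"
    unfolding q_presentation_def using pres fin sub U(1) by auto
  moreover have "card ?K = ?f U + k" using fin by (simp add: card_Plus escapes_def)
  \<comment> \<open>The two opposite bounds at \<open>U\<close> give f(U) + k =
    \<open>dim T\<close>, which is the rank.\<close>
  then have "card {1..rk UNIV} = card ?K" using bound[OF U(1)] U(2) k r by simp
  then obtain h where "bij_betw h {1..rk UNIV} ?K"
    using finite_same_card_bij[of "{1..rk UNIV}" ?K] fin by auto
  ultimately show ?thesis using q_presentation_reindex by blast
qed

end

theorem theorem20:
  fixes scale :: "'a::field \<Rightarrow> 'b::ab_group_add \<Rightarrow> 'b"
    and Basis :: "'b set"
    and rk :: "'b set \<Rightarrow> nat"
    and r :: nat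
  assumes "finite_dimensional_vector_space scale Basis"
    and "vector_space.q_transversal_matroid scale rk"
    and "rk UNIV = r"
  shows "\<exists>X :: nat \<Rightarrow> 'b set. vector_space.q_presentation scale rk {1..r} X"
proof -
  interpret finite_dimensional_vector_space scale Basis by fact
  show ?thesis
    using assms(2,3) q_presentation_card_rank unfolding q_transversal_matroid_def by blast
qed

end
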